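(* Let $a,b,k,\Lambda,\lambda$ be real constants with $a>0$ and $b+k^2+\Lambda=0$, and suppose that the cubic equation $$(\mu^2+b+\lambda^2)(\mu-k)+a^2=0$$ has three distinct roots $m_1,m_2,m_3$. Let $\Phi(x,t)$ be the fundamental matrix, built from these data as described in the context, and let $\gamma$ be the transverse curve in $S^3$ for which $F=\Phi^\dagger$ (conjugate transpose) is a $\lambda$-natural frame, i.e. $\gamma=\pi\circ\Gamma$ where $\Gamma$ is the first column of $F$. Let $L>0$. Then $\gamma$ is closed of length $L$ if and only if there is a cube root of unity $\omega$ such that $$\mathrm{e}^{\mathrm{i} m_j L}=\overline{\omega}\,\mathrm{e}^{\mathrm{i}kL/3}\qquad\text{for } j=1,2,3 .$$
   Context: $\mathbb{C}^3$ carries the Hermitian form $\langle \mathbf z,\mathbf w\rangle=\mathrm{i}(z_3\overline{w_1}-z_1\overline{w_3})+z_2\overline{w_2}$; $SU(2,1)\subset SL(3,\mathbb{C})$ is the subgroup preserving it. The set of complex lines in the null cone $\mathcal N=\{\mathbf z\ne0:\langle\mathbf z,\mathbf z\rangle=0\}$ is identified with $S^3$, and $\pi:\mathcal N\to S^3$ is projectivization. A regular parametrized curve $\gamma(x)$ in $S^3$ is transverse (a T-curve) if it has a lift $\Gamma$ to $\mathcal N$ with $\operatorname{Im}\langle\Gamma_x,\Gamma\rangle\ne0$ everywhere. The functions $z=a\,\mathrm{e}^{-\mathrm{i}N}$, $m=b$, with $N=kx-\Lambda t$, are a plane wave solution of the Yajima-Oikawa equations $z_t=\mathrm{i}(z_{xx}-mz)$,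 $m_t=2(|z|^2)_x$. Fundamental matrix: set $n_j=m_j^2-k^2-\Lambda+\tfrac23\lambda^2$ and $$P=\begin{pmatrix}1&0&0\\0&\mathrm{e}^{-\mathrm{i}N}&0\\0&0&1\end{pmatrix},\quad R=\begin{pmatrix}-1&-1&-1\\ \frac{a}{k-m_1}&\frac{a}{k-m_2}&\frac{a}{k-m_3}\\ \lambda-\mathrm{i}m_1&\lambda-\mathrm{i}m_2&\lambda-\mathrm{i}m_3\end{pmatrix},\quad E=\operatorname{diag}\left(\mathrm{e}^{\mathrm{i}(m_jx+n_jt)}\right)_{j=1,2,3},$$ and, with $P_0=P|_{x=t=0}$, $$\Phi=P\,R\,E\,R^{-1}P_0^{-1}.$$ This $\Phi$ takes values in $SU(2,1)$, equals the identity at $x=t=0$, and $F=\Phi^\dagger$, with columns $\Gamma,B,V$, satisfies the $\lambda$-natural frame equations $$F_x=F\begin{pmatrix}\lambda&-\mathrm{i}\overline z&m\\0&0&z\\1&0&-\lambda\end{pmatrix}.$$ The curve $\gamma$ is regarded, for each fixed $t$, as a parametrized curve $x\mapsto\gamma(x,t)$, $x\in\mathbb{R}$, and "closed of length $L$" means that it is smoothly closed with period $L$ in the parameter $x$: $\gamma(x+L,t)=\gamma(x,t)$ for all $x$ ($L$ need not be the minimal period). *)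

theory Defs
  imports "HOL-Analysis.Analysis"
begin

section \<open>The sphere as the space of null lines\<close>

definition herm :: "complex^3 \<Rightarrow> complex^3 \<Rightarrow> complex" where
  "herm z w = \<i> * (z$3 * cnj (w$1) - z$1 * cnj (w$3)) + z$2 * cnj (w$2)"

definition SU21 :: "(complex^3^3) set" where
  "SU21 = {A. det A = 1 \<and> (\<forall>z w. herm (A *v z) (A *v w) = herm z w)}"

definition null_cone :: "(complex^3) set" where
  "null_cone = {z. z \<noteq> 0 \<and> herm z z = 0}"

text \<open>The complex line through a vector; \<open>vec.span\<close> is the span over the scalar field
  \<open>complex\<close>, as opposed to the real span \<open>span\<close>.\<close>

definition projectivize :: "complex^3 \<Rightarrow> (complex^3) set" where
  "projectivize z = vec.span {z}"

definition S3 :: "(complex^3) set set" where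
  "S3 = projectivize ` null_cone"

definition closed_of_length :: "real \<Rightarrow> (real \<Rightarrow> 'a) \<Rightarrow> bool" where
  "closed_of_length L c \<longleftrightarrow> (\<forall>x. c (x + L) = c x)"


section \<open>Fundamental matrix and natural frame of a plane wave\<close>

definition adjoint_mat :: "complex^'n^'m \<Rightarrow> complex^'m^'n" where
  "adjoint_mat A = (\<chi> i j. cnj (A $ j $ i))"

definition phase :: "real \<Rightarrow> real \<Rightarrow> real \<Rightarrow> real \<Rightarrow> real" where
  "phase k \<Lambda> x t = k * x - \<Lambda> * t"

definition plane_wave :: "real \<Rightarrow> real \<Rightarrow> real \<Rightarrow> real \<Rightarrow> real \<Rightarrow> complex" where
  "plane_wave a k \<Lambda> x t = of_real a * exp (- \<i> * of_real (phase k \<Lambda> x t))"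

definition P_mat :: "real \<Rightarrow> real \<Rightarrow> real \<Rightarrow> real \<Rightarrow> complex^3^3" where
  "P_mat k \<Lambda> x t = vector
     [vector [1, 0, 0],
      vector [0, exp (- \<i> * of_real (phase k \<Lambda> x t)), 0],
      vector [0, 0, 1]]"

text \<open>The three roots are given as a function \<open>m\<close> on the index type \<open>3\<close>,
  whose elements are \<open>1\<close>, \<open>2\<close>, \<open>3\<close>. They may be non-real.\<close>

definition R_mat :: "real \<Rightarrow> real \<Rightarrow> real \<Rightarrow> (3 \<Rightarrow> complex) \<Rightarrow> complex^3^3" where
  "R_mat a k lam m = vector
     [vector [-1, -1, -1],
      vector [of_real a / (of_real k - m 1), of_real a / (of_real k - m 2), of_real a / (of_real k - m 3)],
      vector [of_real lam - \<i> * m 1, of_real lam - \<i> * m 2, of_real lam - \<i> * m 3]]"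

definition t_freq :: "real \<Rightarrow> real \<Rightarrow> real \<Rightarrow> complex \<Rightarrow> complex" where
  "t_freq k \<Lambda> lam \<mu> = \<mu>\<^sup>2 - of_real (k\<^sup>2) - of_real \<Lambda> + 2 / 3 * of_real (lam\<^sup>2)"

definition E_mat :: "real \<Rightarrow> real \<Rightarrow> real \<Rightarrow> (3 \<Rightarrow> complex) \<Rightarrow> real \<Rightarrow> real \<Rightarrow> complex^3^3" where
  "E_mat k \<Lambda> lam m x t =
     (\<chi> i j. if i = j then exp (\<i> * (m j * of_real x + t_freq k \<Lambda> lam (m j) * of_real t)) else 0)"

definition Phi :: "real \<Rightarrow> real \<Rightarrow> real \<Rightarrow> real \<Rightarrow> (3 \<Rightarrow> complex) \<Rightarrow> real \<Rightarrow> real \<Rightarrow> complex^3^3" where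
  "Phi a k \<Lambda> lam m x t =
     P_mat k \<Lambda> x t ** R_mat a k lam m ** E_mat k \<Lambda> lam m x t
       ** matrix_inv (R_mat a k lam m) ** matrix_inv (P_mat k \<Lambda> 0 0)"

definition frame :: "real \<Rightarrow> real \<Rightarrow> real \<Rightarrow> real \<Rightarrow> (3 \<Rightarrow> complex) \<Rightarrow> real \<Rightarrow> real \<Rightarrow> complex^3^3" where
  "frame a k \<Lambda> lam m x t = adjoint_mat (Phi a k \<Lambda> lam m x t)"

definition lift :: "real \<Rightarrow> real \<Rightarrow> real \<Rightarrow> real \<Rightarrow> (3 \<Rightarrow> complex) \<Rightarrow> real \<Rightarrow> real \<Rightarrow> complex^3" where
  "lift a k \<Lambda> lam m x t = column 1 (frame a k \<Lambda> lam m x t)"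

definition T_curve :: "real \<Rightarrow> real \<Rightarrow> real \<Rightarrow> real \<Rightarrow> (3 \<Rightarrow> complex) \<Rightarrow> real \<Rightarrow> real \<Rightarrow> (complex^3) set" where
  "T_curve a k \<Lambda> lam m x t = projectivize (lift a k \<Lambda> lam m x t)"

definition frame_coeff :: "real \<Rightarrow> complex \<Rightarrow> real \<Rightarrow> complex^3^3" where
  "frame_coeff lam z mm = vector
     [vector [of_real lam, - \<i> * cnj z, of_real mm],
      vector [0, 0, z],
      vector [1, 0, - of_real lam]]"


section \<open>The frame is a natural frame of a transverse curve in the sphere\<close>

text \<open>Gram matrix of the form: \<open>herm z w\<close> is the adjoint of \<open>w\<close> times \<open>J_mat\<close> times \<open>z\<close>.\<close>

definition J_mat :: "complex^3^3" where
  "J_mat = vector [vector [0, 0, \<i>], vector [0, 1, 0], vector [- \<i>, 0, 0]]"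

lemma adjoint_mult: "adjoint_mat (A ** B) = adjoint_mat B ** adjoint_mat A"
  for A :: "complex^'n^'m" and B :: "complex^'p^'n"
  by (simp add: adjoint_mat_def matrix_matrix_mult_def vec_eq_iff mult.commute)

lemma adjoint_adjoint [simp]: "adjoint_mat (adjoint_mat A) = A"
  by (simp add: adjoint_mat_def vec_eq_iff)

lemma adjoint_one [simp]: "adjoint_mat (mat 1) = mat 1"
  by (simp add: adjoint_mat_def mat_def vec_eq_iff)

lemma det_adjoint: "det (adjoint_mat A) = cnj (det A)" for A :: "complex^3^3"
  by (simp add: adjoint_mat_def det_3)

lemma J_sq: "J_mat ** J_mat = mat 1"
  by (simp add: J_mat_def matrix_matrix_mult_def mat_def vec_eq_iff forall_3 sum_3)

lemma herm_preserve:
  assumes "adjoint_mat A ** J_mat ** A = J_mat"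
  shows "herm (A *v z) (A *v w) = herm z w"
proof -
  have h: "herm z w = (\<Sum>i\<in>UNIV. cnj (w$i) * (J_mat *v z) $ i)" for z w
    by (simp add: herm_def J_mat_def matrix_vector_mult_def sum_3 algebra_simps)
  have adj: "(\<Sum>i\<in>UNIV. cnj ((A *v w)$i) * y $ i) = (\<Sum>i\<in>UNIV. cnj (w$i) * (adjoint_mat A *v y) $ i)" for w y
    by (simp add: adjoint_mat_def matrix_vector_mult_def sum_3 algebra_simps)
  show ?thesis
    using assms by (simp add: h adj matrix_vector_mul_assoc matrix_mul_assoc)
qed

context
  fixes a b k \<Lambda> lam :: real and m :: "3 \<Rightarrow> complex"
  assumes a: "a > 0"
    and disp: "b + k\<^sup>2 + \<Lambda> = 0"
    and m_inj: "inj m"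
    and m_root: "\<And>j. ((m j)\<^sup>2 + of_real b + of_real (lam\<^sup>2)) * (m j - of_real k) + of_real (a\<^sup>2) = 0"
begin

lemma m_neq_k: "m j \<noteq> of_real k" "of_real k - m j \<noteq> 0"
  using m_root[of j] a by auto

lemma m_distinct: "m 1 \<noteq> m 2" "m 2 \<noteq> m 3" "m 1 \<noteq> m 3"
  using m_inj by (auto dest!: injD)

lemma m_sum: "m 1 + m 2 + m 3 = of_real k"
  and m_sum2: "(m 1)\<^sup>2 + (m 2)\<^sup>2 + (m 3)\<^sup>2 = of_real (k\<^sup>2) - 2 * (of_real b + of_real (lam\<^sup>2))"
proof -
  let ?s = "of_real b + of_real (lam\<^sup>2) :: complex"
  have d: "(m i)\<^sup>2 + m i * m j + (m j)\<^sup>2 - of_real k * (m i + m j) + ?s = 0" if "m i \<noteq> m j" for i j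
  proof -
    have "(m i - m j) * ((m i)\<^sup>2 + m i * m j + (m j)\<^sup>2 - of_real k * (m i + m j) + ?s) = 0"
      using m_root[of i] m_root[of j] by algebra
    then show ?thesis using that by simp
  qed
  have "(m 2 - m 3) * (m 1 + m 2 + m 3 - of_real k) = 0"
    using d[OF m_distinct(1)] d[OF m_distinct(3)] by algebra
  then show s: "m 1 + m 2 + m 3 = of_real k"
    using m_distinct(2) by simp
  show "(m 1)\<^sup>2 + (m 2)\<^sup>2 + (m 3)\<^sup>2 = of_real (k\<^sup>2) - 2 * ?s"
    using d[OF m_distinct(1)] unfolding of_real_power s[symmetric] by algebra
qed

lemma R_invertible: "invertible (R_mat a k lam m)"
proof -
  have u: "of_real a / (of_real k - m j) * (of_real k - m j) = of_real a" for j
    using m_neq_k(2)[of j] by simp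
  have alg: "D * (d1 * d2 * d3) = - (\<i> * A * ((m1 - m2) * (m2 - m3) * (m3 - m1)))"
    if "d1 = K - m1" "d2 = K - m2" "d3 = K - m3" "u1 * d1 = A" "u2 * d2 = A" "u3 * d3 = A"
      "D = \<i> * (u2 * m3 - u3 * m2 - (u1 * m3 - u3 * m1) + u1 * m2 - u2 * m1)"
    for D d1 d2 d3 A K m1 m2 m3 u1 u2 u3 :: complex
    using that by algebra
  have "det (R_mat a k lam m) * ((of_real k - m 1) * (of_real k - m 2) * (of_real k - m 3))
      = - (\<i> * of_real a * ((m 1 - m 2) * (m 2 - m 3) * (m 3 - m 1)))"
    by (rule alg[OF refl refl refl u u u])
      (simp add: R_mat_def det_3 algebra_simps add_divide_distrib diff_divide_distrib)
  then have "det (R_mat a k lam m) \<noteq> 0"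
    using m_distinct a by auto
  then show ?thesis by (simp add: invertible_det_nz)
qed

lemma R_inv: "R_mat a k lam m ** matrix_inv (R_mat a k lam m) = mat 1"
  using R_invertible unfolding invertible_def matrix_inv_def by (metis (mono_tags, lifting) someI_ex)

lemma P0: "matrix_inv (P_mat k \<Lambda> 0 0) = mat 1"
proof -
  have P: "P_mat k \<Lambda> 0 0 = mat 1"
    by (simp add: P_mat_def phase_def mat_def vec_eq_iff forall_3)
  have "P_mat k \<Lambda> 0 0 ** matrix_inv (P_mat k \<Lambda> 0 0) = mat 1"
    unfolding matrix_inv_def by (rule someI2[where a = "mat 1"]) (simp_all add: P)
  then show ?thesis by (simp add: P)
qed

lemma Phi_eq: "Phi a k \<Lambda> lam m x t =
    P_mat k \<Lambda> x t ** R_mat a k lam m ** E_mat k \<Lambda> lam m x t ** matrix_inv (R_mat a k lam m)"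
  by (simp add: Phi_def P0)

lemma Phi_0: "Phi a k \<Lambda> lam m 0 0 = mat 1"
proof -
  have "P_mat k \<Lambda> 0 0 = mat 1" "E_mat k \<Lambda> lam m 0 0 = mat 1"
    by (simp_all add: P_mat_def E_mat_def phase_def mat_def vec_eq_iff forall_3)
  then show ?thesis by (simp add: Phi_eq R_inv)
qed

lemma t_freq_sum: "t_freq k \<Lambda> lam (m 1) + t_freq k \<Lambda> lam (m 2) + t_freq k \<Lambda> lam (m 3) = - of_real \<Lambda>"
proof -
  have "of_real b = - of_real (k\<^sup>2) - (of_real \<Lambda> :: complex)"
    using arg_cong[OF disp, of complex_of_real] by (simp add: algebra_simps eq_neg_iff_add_eq_0)
  then show ?thesis
    using m_sum2 unfolding t_freq_def by algebra
qed

lemma det_Phi: "det (Phi a k \<Lambda> lam m x t) = 1"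
proof -
  have dP: "det (P_mat k \<Lambda> x t) = exp (- \<i> * of_real (phase k \<Lambda> x t))"
    by (simp add: P_mat_def det_3)
  have "det (E_mat k \<Lambda> lam m x t) = exp (\<i> * ((m 1 + m 2 + m 3) * of_real x
      + (t_freq k \<Lambda> lam (m 1) + t_freq k \<Lambda> lam (m 2) + t_freq k \<Lambda> lam (m 3)) * of_real t))"
    by (simp add: E_mat_def det_3 flip: exp_add) (simp add: algebra_simps)
  also have "\<dots> = exp (\<i> * of_real (phase k \<Lambda> x t))"
    unfolding m_sum t_freq_sum by (simp add: phase_def)
  finally have dE: "det (E_mat k \<Lambda> lam m x t) = exp (\<i> * of_real (phase k \<Lambda> x t))" .
  have dR: "det (R_mat a k lam m) * det (matrix_inv (R_mat a k lam m)) = 1"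
    using R_inv by (metis det_I det_mul)
  have "det (Phi a k \<Lambda> lam m x t) = (det (P_mat k \<Lambda> x t) * det (E_mat k \<Lambda> lam m x t)) *
      (det (R_mat a k lam m) * det (matrix_inv (R_mat a k lam m)))"
    by (simp add: Phi_eq det_mul)
  then show ?thesis
    by (simp add: dR dP dE exp_minus)
qed

lemma gram_zero:
  assumes "m j \<noteq> cnj (m i)"
  shows "(adjoint_mat (R_mat a k lam m) ** J_mat ** R_mat a k lam m) $ i $ j = 0"
proof -
  have alg: "- (p + q) + (A / (K - q)) * (A / (K - p)) = 0"
    if "p \<noteq> q" "(p\<^sup>2 + s) * (p - K) + A\<^sup>2 = 0" "(q\<^sup>2 + s) * (q - K) + A\<^sup>2 = 0" "K - p \<noteq> 0" "K - q \<noteq> 0"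
    for p q s A K :: complex
  proof -
    have "(p - q) * (A * A - (p + q) * ((K - q) * (K - p))) = 0"
      using that(2,3) by algebra
    then have "A * A = (p + q) * ((K - q) * (K - p))"
      using that(1) by simp
    then show ?thesis using that(4,5) by simp
  qed
  have q: "((cnj (m i))\<^sup>2 + (of_real b + of_real (lam\<^sup>2))) * (cnj (m i) - of_real k) + (of_real a)\<^sup>2 = 0"
    using arg_cong[OF m_root[of i], of cnj] by (simp add: add.assoc)
  have p: "((m j)\<^sup>2 + (of_real b + of_real (lam\<^sup>2))) * (m j - of_real k) + (of_real a)\<^sup>2 = 0"
    using m_root[of j] by (simp add: add.assoc)
  have nz: "of_real k - cnj (m i) \<noteq> 0"
    using m_neq_k(2)[of i] by (metis complex_cnj_cnj complex_cnj_complex_of_real eq_iff_diff_eq_0)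
  have "(adjoint_mat (R_mat a k lam m) ** J_mat ** R_mat a k lam m) $ i $ j =
      - (m j + cnj (m i)) + (of_real a / (of_real k - cnj (m i))) * (of_real a / (of_real k - m j))"
    using exhaust_3[of i] exhaust_3[of j]
    by (auto simp: adjoint_mat_def J_mat_def R_mat_def matrix_matrix_mult_def sum_3 algebra_simps)
  then show ?thesis
    using alg[OF assms p q m_neq_k(2) nz] by simp
qed

lemma Phi_J: "adjoint_mat (Phi a k \<Lambda> lam m x t) ** J_mat ** Phi a k \<Lambda> lam m x t = J_mat"
proof -
  let ?P = "P_mat k \<Lambda> x t" and ?R = "R_mat a k lam m" and ?E = "E_mat k \<Lambda> lam m x t"
  let ?S = "matrix_inv ?R"
  have P: "adjoint_mat ?P ** J_mat ** ?P = J_mat"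
    by (simp add: P_mat_def J_mat_def adjoint_mat_def matrix_matrix_mult_def vec_eq_iff forall_3 sum_3
        exp_cnj flip: exp_add)
  define H where "H = adjoint_mat ?R ** J_mat ** ?R"
  define e where "e j = exp (\<i> * (m j * of_real x + t_freq k \<Lambda> lam (m j) * of_real t))" for j
  have E: "adjoint_mat ?E ** H ** ?E = H"
  proof -
    have "cnj (e i) * H $ i $ j * e j = H $ i $ j" for i j
    proof (cases "m j = cnj (m i)")
      case True
      then have "cnj (e i) * e j = 1"
        by (simp add: e_def t_freq_def exp_cnj flip: exp_add)
      then show ?thesis by (simp add: mult.assoc mult.left_commute)
    next
      case False
      then show ?thesis by (simp add: H_def gram_zero)
    qed
    moreover have "(adjoint_mat ?E ** H ** ?E) $ i $ j = cnj (e i) * H $ i $ j * e j" for i j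
      by (simp add: E_mat_def e_def adjoint_mat_def matrix_matrix_mult_def if_distrib if_distribR
          sum.delta cong: if_cong)
    ultimately show ?thesis by (simp add: vec_eq_iff)
  qed
  have "adjoint_mat (Phi a k \<Lambda> lam m x t) ** J_mat ** Phi a k \<Lambda> lam m x t
      = adjoint_mat ?S ** (adjoint_mat ?E ** (adjoint_mat ?R ** (adjoint_mat ?P ** J_mat ** ?P) ** ?R) ** ?E) ** ?S"
    by (simp add: Phi_eq adjoint_mult matrix_mul_assoc)
  also have "\<dots> = adjoint_mat ?S ** H ** ?S"
    by (simp only: P H_def[symmetric] E)
  also have "\<dots> = adjoint_mat (?R ** ?S) ** J_mat ** (?R ** ?S)"
    by (simp only: H_def adjoint_mult matrix_mul_assoc)
  finally show ?thesis by (simp add: R_inv)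
qed

lemma Phi_in_SU21: "Phi a k \<Lambda> lam m x t \<in> SU21"
  by (simp add: SU21_def det_Phi herm_preserve Phi_J)

lemma frame_in_SU21: "frame a k \<Lambda> lam m x t \<in> SU21"
proof -
  let ?\<Phi> = "Phi a k \<Lambda> lam m x t"
  have "(J_mat ** adjoint_mat ?\<Phi> ** J_mat) ** ?\<Phi> = J_mat ** (adjoint_mat ?\<Phi> ** J_mat ** ?\<Phi>)"
    by (simp add: matrix_mul_assoc)
  then have "?\<Phi> ** (J_mat ** adjoint_mat ?\<Phi> ** J_mat) = mat 1"
    by (simp only: Phi_J J_sq matrix_left_right_inverse)
  then have "?\<Phi> ** (J_mat ** adjoint_mat ?\<Phi> ** J_mat) ** J_mat = J_mat"
    by simp
  then have "?\<Phi> ** J_mat ** adjoint_mat ?\<Phi> ** (J_mat ** J_mat) = J_mat"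
    by (simp only: matrix_mul_assoc)
  then show ?thesis
    by (simp add: SU21_def frame_def det_adjoint det_Phi herm_preserve J_sq)
qed

lemma frame_0: "frame a k \<Lambda> lam m 0 0 = mat 1"
  by (simp add: frame_def Phi_0)

lemma Phi_deriv:
  "((\<lambda>x. Phi a k \<Lambda> lam m x t $ i $ j) has_vector_derivative
     (adjoint_mat (frame_coeff lam (plane_wave a k \<Lambda> x t) b) ** Phi a k \<Lambda> lam m x t) $ i $ j) (at x)"
proof -
  let ?M = "adjoint_mat (frame_coeff lam (plane_wave a k \<Lambda> x t) b)"
  let ?Y = "\<lambda>x. P_mat k \<Lambda> x t ** R_mat a k lam m ** E_mat k \<Lambda> lam m x t"
  define e where "e l x = exp (\<i> * (m l * of_real x + t_freq k \<Lambda> lam (m l) * of_real t))" for l x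
  define p where "p x = exp (- \<i> * of_real (phase k \<Lambda> x t))" for x
  have de: "(e l has_vector_derivative \<i> * m l * e l x) (at x)" for l x
    unfolding e_def by (rule has_vector_derivative_real_field) (auto intro!: derivative_eq_intros)
  have dp: "(p has_vector_derivative - \<i> * of_real k * p x) (at x)" for x
    unfolding p_def phase_def of_real_diff of_real_mult
    by (rule has_vector_derivative_real_field) (auto intro!: derivative_eq_intros)
  have pp: "cnj (p x) * p x = 1" for x
    by (simp add: p_def exp_cnj flip: exp_add)
  have y1: "?Y x $ 1 $ l = - e l x" for x l
    using exhaust_3[of l]
    by (auto simp: P_mat_def R_mat_def E_mat_def e_def matrix_matrix_mult_def sum_3)
  have y2: "?Y x $ 2 $ l = of_real a / (of_real k - m l) * (p x * e l x)" for x l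
    using exhaust_3[of l]
    by (auto simp: P_mat_def R_mat_def E_mat_def e_def p_def matrix_matrix_mult_def sum_3)
  have y3: "?Y x $ 3 $ l = (of_real lam - \<i> * m l) * e l x" for x l
    using exhaust_3[of l]
    by (auto simp: P_mat_def R_mat_def E_mat_def e_def matrix_matrix_mult_def sum_3)
  have pw: "plane_wave a k \<Lambda> x t = of_real a * p x" for x
    by (simp add: plane_wave_def p_def)
  have dY: "((\<lambda>x. ?Y x $ i $ l) has_vector_derivative (?M ** ?Y x) $ i $ l) (at x)" for i l
  proof -
    let ?u = "of_real a / (of_real k - m l)"
    have u: "?u * (of_real k - m l) = of_real a"
      using m_neq_k(2)[of l] by simp
    have au: "of_real a * ?u = (m l)\<^sup>2 + of_real b + (of_real lam)\<^sup>2"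
      using m_root[of l] m_neq_k(2)[of l] by (simp add: field_simps power2_eq_square)
    have mm: "(?M ** ?Y x) $ i $ l = ?M $ i $ 1 * ?Y x $ 1 $ l + ?M $ i $ 2 * ?Y x $ 2 $ l + ?M $ i $ 3 * ?Y x $ 3 $ l"
      for i
      by (subst matrix_matrix_mult_def) (simp only: vec_lambda_beta sum_3)
    have M1: "(?M ** ?Y x) $ 1 $ l = \<i> * m l * (- e l x)"
      unfolding mm y1 y2 y3 by (simp add: frame_coeff_def adjoint_mat_def algebra_simps)
    have M2: "(?M ** ?Y x) $ 2 $ l = \<i> * (of_real a * p x) * (- e l x)"
      unfolding mm y1 y2 y3 by (simp add: frame_coeff_def adjoint_mat_def pw algebra_simps)
    have "(?M ** ?Y x) $ 3 $ l = of_real b * (- e l x) + (of_real a * ?u) * (cnj (p x) * p x) * e l x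
        - of_real lam * ((of_real lam - \<i> * m l) * e l x)"
      unfolding mm y1 y2 y3 by (simp add: frame_coeff_def adjoint_mat_def pw algebra_simps)
    also have "\<dots> = (of_real lam - \<i> * m l) * (\<i> * m l * e l x)"
      unfolding pp au by (simp add: algebra_simps power2_eq_square)
    finally have M3: "(?M ** ?Y x) $ 3 $ l = (of_real lam - \<i> * m l) * (\<i> * m l * e l x)" .
    have D1: "((\<lambda>x. - e l x) has_vector_derivative \<i> * m l * (- e l x)) (at x)"
      using has_vector_derivative_minus[OF de] by simp
    have "((\<lambda>x. ?u * (p x * e l x)) has_vector_derivative
        ?u * (p x * (\<i> * m l * e l x) + - \<i> * of_real k * p x * e l x)) (at x)"
      by (intro has_vector_derivative_mult_right has_vector_derivative_mult de dp)
    moreover have "w * (p x * (\<i> * m l * e l x) + - \<i> * of_real k * p x * e l x)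
        = - \<i> * (w * (of_real k - m l)) * p x * e l x" for w
      by (simp add: algebra_simps)
    ultimately have D2: "((\<lambda>x. ?u * (p x * e l x)) has_vector_derivative
        \<i> * (of_real a * p x) * (- e l x)) (at x)"
      by (simp only: u) (simp add: mult.assoc)
    have D3: "((\<lambda>x. (of_real lam - \<i> * m l) * e l x) has_vector_derivative
        (of_real lam - \<i> * m l) * (\<i> * m l * e l x)) (at x)"
      by (intro has_vector_derivative_mult_right de)
    from exhaust_3[of i] show ?thesis
      by (elim disjE) (simp_all only: y1 y2 y3 M1 M2 M3 D1 D2 D3)
  qed
  have "((\<lambda>x. \<Sum>l\<in>UNIV. ?Y x $ i $ l * matrix_inv (R_mat a k lam m) $ l $ j) has_vector_derivative
      (\<Sum>l\<in>UNIV. (?M ** ?Y x) $ i $ l * matrix_inv (R_mat a k lam m) $ l $ j)) (at x)"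
    by (intro has_vector_derivative_sum has_vector_derivative_mult_left dY)
  then have "((\<lambda>x. (?Y x ** matrix_inv (R_mat a k lam m)) $ i $ j) has_vector_derivative
      ((?M ** ?Y x) ** matrix_inv (R_mat a k lam m)) $ i $ j) (at x)"
    by (simp only: matrix_matrix_mult_def[of _ "matrix_inv _"] vec_lambda_beta)
  then show ?thesis
    by (simp only: Phi_eq matrix_mul_assoc)
qed

lemma frame_deriv:
  "((\<lambda>x. frame a k \<Lambda> lam m x t $ i $ j) has_vector_derivative
     (frame a k \<Lambda> lam m x t ** frame_coeff lam (plane_wave a k \<Lambda> x t) b) $ i $ j) (at x)"
proof -
  let ?M = "frame_coeff lam (plane_wave a k \<Lambda> x t) b"
  have "frame a k \<Lambda> lam m x t ** ?M = adjoint_mat (adjoint_mat ?M ** Phi a k \<Lambda> lam m x t)"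
    by (simp add: adjoint_mult frame_def)
  then show ?thesis
    using has_vector_derivative_cnj[OF Phi_deriv[of t j i x]]
    by (simp add: frame_def adjoint_mat_def)
qed

lemma herm_frame_columns:
  "herm (column i (frame a k \<Lambda> lam m x t)) (column j (frame a k \<Lambda> lam m x t)) = herm (axis i 1) (axis j 1)"
proof -
  have "column i A = A *v axis i 1" for i and A :: "complex^3^3"
    using exhaust_3[of i]
    by (auto simp: vec_eq_iff column_def axis_def matrix_vector_mult_def sum_3)
  then show ?thesis
    using frame_in_SU21[of x t] by (simp only: SU21_def mem_Collect_eq)
qed

lemma lift_null: "lift a k \<Lambda> lam m x t \<in> null_cone"
proof -
  let ?F = "frame a k \<Lambda> lam m x t"
  have "herm (column 3 ?F) (column 1 ?F) = \<i>" "herm (column 1 ?F) (column 1 ?F) = 0"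
    unfolding herm_frame_columns by (simp_all add: herm_def axis_def)
  moreover have "herm v 0 = 0" for v
    by (simp add: herm_def)
  ultimately show ?thesis
    by (auto simp: null_cone_def lift_def)
qed

lemma T_curve_in_S3: "T_curve a k \<Lambda> lam m x t \<in> S3"
  by (simp add: T_curve_def S3_def lift_null)

lemma T_curve_transverse:
  assumes "\<And>i. ((\<lambda>x. lift a k \<Lambda> lam m x t $ i) has_vector_derivative D $ i) (at x)"
  shows "Im (herm D (lift a k \<Lambda> lam m x t)) = 1"
proof -
  let ?F = "frame a k \<Lambda> lam m x t"
  have "D $ i = (?F ** frame_coeff lam (plane_wave a k \<Lambda> x t) b) $ i $ 1" for i
    using assms[of i] frame_deriv[of t i 1 x]
    by (auto simp: lift_def column_def intro: vector_derivative_unique_at)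
  then have D: "D $ i = of_real lam * column 1 ?F $ i + column 3 ?F $ i" for i
    by (simp add: matrix_matrix_mult_def sum_3 frame_coeff_def column_def)
  have "herm D (column 1 ?F) = of_real lam * herm (column 1 ?F) (column 1 ?F) + herm (column 3 ?F) (column 1 ?F)"
    by (simp add: herm_def D algebra_simps)
  also have "\<dots> = \<i>"
    unfolding herm_frame_columns by (simp add: herm_def axis_def)
  finally show ?thesis by (simp add: lift_def)
qed

end

end

theory Submission
  imports Defs
begin

text \<open>
  Multiplying the lift \<open>\<Gamma>\<close> by the constant invertible matrix \<open>R\<^sup>\<dagger>\<close> gives a vector whose
  \<open>j\<close>-th entry is, up to sign and conjugation, the single exponential with frequency \<open>m\<^sub>j\<close>
  (\<open>lift_in_mode_coordinates\<close>). In these coordinates the shift \<open>x \<mapsto> x + L\<close> is diagonal, with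
  entries \<open>cnj (exp (\<i> m\<^sub>j L))\<close> that depend neither on \<open>x\<close> nor on \<open>t\<close>, and no coordinate of the
  lift ever vanishes. So the complex line through \<open>\<Gamma>\<close> returns to itself after the parameter
  length \<open>L\<close> exactly when these three multipliers coincide (\<open>lift_shift_iff\<close>), and it is enough
  to test this at one point of the curve.

  It remains to name the common value \<open>c\<close> of \<open>exp (\<i> m\<^sub>j L)\<close>. The roots of the cubic add up to
  \<open>k\<close>, so \<open>c\<^sup>3 = exp (\<i> k L)\<close>, which says that \<open>c\<close> and \<open>exp (\<i> k L / 3)\<close> differ by a cube
  root of unity.
\<close>

lemma projectivize_eq_iff:
  "projectivize v = projectivize w \<longleftrightarrow> (\<exists>c. c \<noteq> 0 \<and> v = c *s w)"
proof
  assume eq: "projectivize v = projectivize w"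
  then have "v \<in> vec.span {w}"
    unfolding projectivize_def using vec.span_base[of v "{v}"] by simp
  then obtain c where c: "v = c *s w"
    by (auto simp: vec.span_singleton)
  show "\<exists>c. c \<noteq> 0 \<and> v = c *s w"
  proof (cases "c = 0")
    case True
    then have "w = 0"
      using eq c vec.span_base[of w "{w}"] by (auto simp: projectivize_def)
    then show ?thesis
      using c by (intro exI[of _ 1]) simp
  qed (use c in blast)
next
  assume "\<exists>c. c \<noteq> 0 \<and> v = c *s w"
  then obtain c where c: "c \<noteq> 0" "v = c *s w"
    by blast
  then have w: "w = inverse c *s v"
    by simp
  have "v \<in> vec.span {w}" "w \<in> vec.span {v}"
    using c(2) w by (metis vec.span_base vec.span_scale singletonI)+
  then show "projectivize v = projectivize w"
    unfolding projectivize_def by (simp add: vec.span_eq)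
qed

context
  fixes a b k \<Lambda> lam :: real and m :: "3 \<Rightarrow> complex"
  assumes a: "a > 0"
    and disp: "b + k\<^sup>2 + \<Lambda> = 0"
    and m_inj: "inj m"
    and m_root: "\<And>j. ((m j)\<^sup>2 + of_real b + of_real (lam\<^sup>2)) * (m j - of_real k) + of_real (a\<^sup>2) = 0"
begin

text \<open>
  The first row of \<open>\<Phi> R = P R E\<close> is the first row of \<open>R E\<close>, because the first row of \<open>P\<close> is a
  unit vector; the first row of \<open>R\<close> consists of \<open>-1\<close>s, so that only the exponentials remain.
\<close>

lemma lift_in_mode_coordinates:
  "(adjoint_mat (R_mat a k lam m) *v lift a k \<Lambda> lam m x t) $ j =
    - cnj (exp (\<i> * (m j * of_real x + t_freq k \<Lambda> lam (m j) * of_real t)))"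
proof -
  let ?R = "R_mat a k lam m" and ?\<Phi> = "Phi a k \<Lambda> lam m x t"
  let ?PRE = "P_mat k \<Lambda> x t ** ?R ** E_mat k \<Lambda> lam m x t"
  have "matrix_inv ?R ** ?R = mat 1"
    using R_inv[OF a disp m_inj m_root] by (simp add: matrix_left_right_inverse)
  then have "?\<Phi> ** ?R = ?PRE"
    by (simp add: Phi_eq[OF a disp m_inj m_root] matrix_mul_assoc[symmetric])
  then have "cnj ((?\<Phi> ** ?R) $ 1 $ j) = cnj (?PRE $ 1 $ j)"
    by simp
  moreover have "(adjoint_mat ?R *v lift a k \<Lambda> lam m x t) $ j = cnj ((?\<Phi> ** ?R) $ 1 $ j)"
    by (simp add: lift_def frame_def column_def adjoint_mat_def matrix_vector_mult_def
        matrix_matrix_mult_def mult.commute)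
  moreover have "?PRE $ 1 $ j = - exp (\<i> * (m j * of_real x + t_freq k \<Lambda> lam (m j) * of_real t))"
    using exhaust_3[of j]
    by (auto simp: P_mat_def R_mat_def E_mat_def matrix_matrix_mult_def sum_3)
  ultimately show ?thesis
    by simp
qed

lemma adjoint_R_cancel:
  "adjoint_mat (R_mat a k lam m) *v u = adjoint_mat (R_mat a k lam m) *v v \<longleftrightarrow> u = v"
proof
  let ?R = "R_mat a k lam m"
  have "adjoint_mat (matrix_inv ?R) ** adjoint_mat ?R = mat 1"
    using R_inv[OF a disp m_inj m_root] by (simp flip: adjoint_mult)
  then have undo: "adjoint_mat (matrix_inv ?R) *v (adjoint_mat ?R *v w) = w" for w
    by (simp add: matrix_vector_mul_assoc)
  assume "adjoint_mat ?R *v u = adjoint_mat ?R *v v"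
  then show "u = v"
    using undo by metis
qed simp

text \<open>
  The condition on the right does not involve \<open>x\<close>: a multiplier \<open>c\<close> that works at one point of
  the curve works at every point.
\<close>

lemma lift_shift_iff:
  "lift a k \<Lambda> lam m (x + L) t = c *s lift a k \<Lambda> lam m x t \<longleftrightarrow>
    (\<forall>j. cnj (exp (\<i> * m j * of_real L)) = c)"
proof -
  let ?R' = "adjoint_mat (R_mat a k lam m)"
  let ?e = "\<lambda>j x. exp (\<i> * (m j * of_real x + t_freq k \<Lambda> lam (m j) * of_real t))"
  have shift: "?e j (x + L) = exp (\<i> * m j * of_real L) * ?e j x" for j
    by (simp add: exp_add[symmetric] algebra_simps)
  have "lift a k \<Lambda> lam m (x + L) t = c *s lift a k \<Lambda> lam m x t \<longleftrightarrow>
      ?R' *v lift a k \<Lambda> lam m (x + L) t = c *s (?R' *v lift a k \<Lambda> lam m x t)"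
    using adjoint_R_cancel by (simp flip: vector_scalar_commute)
  also have "\<dots> \<longleftrightarrow> (\<forall>j. cnj (exp (\<i> * m j * of_real L)) * cnj (?e j x) = c * cnj (?e j x))"
    unfolding vec_eq_iff vector_smult_component lift_in_mode_coordinates shift by simp
  also have "\<dots> \<longleftrightarrow> (\<forall>j. cnj (exp (\<i> * m j * of_real L)) = c)"
    by simp
  finally show ?thesis .
qed

lemma closed_iff_equal_multipliers:
  "closed_of_length L (\<lambda>x. T_curve a k \<Lambda> lam m x t) \<longleftrightarrow>
    (\<exists>c. \<forall>j. exp (\<i> * m j * of_real L) = c)"
proof -
  have "closed_of_length L (\<lambda>x. T_curve a k \<Lambda> lam m x t) \<longleftrightarrow>
      (\<exists>c. c \<noteq> 0 \<and> (\<forall>j. cnj (exp (\<i> * m j * of_real L)) = c))"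
    unfolding closed_of_length_def T_curve_def projectivize_eq_iff lift_shift_iff by simp
  also have "\<dots> \<longleftrightarrow> (\<exists>c. \<forall>j. exp (\<i> * m j * of_real L) = c)"
    by (metis complex_cnj_cancel_iff complex_cnj_zero_iff exp_not_eq_zero)
  finally show ?thesis .
qed

lemma prod_multipliers:
  "exp (\<i> * m 1 * of_real L) * exp (\<i> * m 2 * of_real L) * exp (\<i> * m 3 * of_real L) =
    exp (\<i> * of_real k * of_real L)"
  by (simp add: m_sum[OF a disp m_inj m_root, symmetric] exp_add[symmetric] algebra_simps)

end

theorem proposition2:
  fixes a b k \<Lambda> lam L t :: real and m :: "3 \<Rightarrow> complex"
  assumes "a > 0"
    and "b + k\<^sup>2 + \<Lambda> = 0"
    and "inj m"
    and "\<And>j. ((m j)\<^sup>2 + of_real b + of_real (lam\<^sup>2)) * (m j - of_real k) + of_real (a\<^sup>2) = 0"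
    and "L > 0"
  shows "closed_of_length L (\<lambda>x. T_curve a k \<Lambda> lam m x t) \<longleftrightarrow>
    (\<exists>\<omega>::complex. \<omega> ^ 3 = 1 \<and>
      (\<forall>j. exp (\<i> * m j * of_real L) = cnj \<omega> * exp (\<i> * of_real k * of_real L / 3)))"
proof -
  let ?r = "exp (\<i> * of_real k * of_real L / 3)"
  have r3: "?r ^ 3 = exp (\<i> * of_real k * of_real L)"
    by (simp flip: exp_of_nat_mult)
  have "\<exists>\<omega>. \<omega> ^ 3 = 1 \<and> (\<forall>j. exp (\<i> * m j * of_real L) = cnj \<omega> * ?r)"
    if c: "\<forall>j. exp (\<i> * m j * of_real L) = c" for c
  proof (intro exI conjI)
    have "c ^ 3 = ?r ^ 3"
      using prod_multipliers[OF assms(1-4), of L] c r3 by (simp add: power3_eq_cube)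
    then have "(c / ?r) ^ 3 = 1"
      by (simp add: power_divide)
    then show "cnj (c / ?r) ^ 3 = 1"
      by (metis complex_cnj_power complex_cnj_one)
    show "\<forall>j. exp (\<i> * m j * of_real L) = cnj (cnj (c / ?r)) * ?r"
      using c by simp
  qed
  then show ?thesis
    unfolding closed_iff_equal_multipliers[OF assms(1-4)] by blast
qed

end
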